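(* Let $m\ge 2$ and $n\ge 1$ be integers, and let $H(n,m):=K_m^n$ be the Hamming graph. For all nonempty $A\subseteq V(H(n,m))$, $$e_{H(n,m)}(A,A^c)\ge|A|\cdot(m-1)\cdot\bigl(n-\log_m|A|\bigr).$$ Moreover, equality holds whenever $A$ induces a copy of $H(t,m)$ for some $t\in[n]$.
   Context: $[n]$ denotes $\{1,\dots,n\}$. For a graph $G$ and $A\subseteq V(G)$, $A^c=V(G)\setminus A$ and $e_G(A,A^c)$ is the number of edges of $G$ with exactly one endpoint in $A$. $K_m$ is the complete graph on $m$ vertices. $G^n$ denotes the product graph $G\square\cdots\square G$ ($n$ copies): its vertex set is $V(G)^n$ and its edges are all pairs $\{u,v\}$ for which there is an index $j\in[n]$ such that $u_jv_j\in E(G)$ and $u_l=v_l$ for all $l\neq j$. *)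

theory Defs
  imports Complex_Main
begin

text \<open>Simple graphs are given by a vertex set and a set of two-element sets of vertices.\<close>

record 'a graph =
  verts :: "'a set"
  edges :: "'a set set"

definition complete_graph :: "nat \<Rightarrow> nat graph" where
  "complete_graph m =
     \<lparr>verts = {1..m}, edges = {{u, v} | u v. u \<in> {1..m} \<and> v \<in> {1..m} \<and> u \<noteq> v}\<rparr>"

text \<open>The vertices of the product of \<open>n\<close> copies of \<open>G\<close> are the lists of length \<open>n\<close> over the
  vertices of \<open>G\<close>, so coordinates are numbered from \<open>0\<close> to \<open>n - 1\<close>.\<close>

definition power_verts :: "'a graph \<Rightarrow> nat \<Rightarrow> 'a list set" where
  "power_verts G n = {u. set u \<subseteq> verts G \<and> length u = n}"

definition power_graph :: "'a graph \<Rightarrow> nat \<Rightarrow> 'a list graph" where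
  "power_graph G n =
     \<lparr>verts = power_verts G n,
      edges = {{u, v} | u v. u \<in> power_verts G n \<and> v \<in> power_verts G n \<and>
                 (\<exists>j<n. {u ! j, v ! j} \<in> edges G \<and> (\<forall>l<n. l \<noteq> j \<longrightarrow> u ! l = v ! l))}\<rparr>"

definition hamming_graph :: "nat \<Rightarrow> nat \<Rightarrow> nat list graph" where
  "hamming_graph n m = power_graph (complete_graph m) n"

text \<open>The number \<open>e\<^sub>G(A, A\<^sup>c)\<close> of edges with exactly one endpoint in \<open>A\<close>.\<close>

definition edge_boundary :: "'a graph \<Rightarrow> 'a set \<Rightarrow> nat" where
  "edge_boundary G A = card {e \<in> edges G. card (e \<inter> A) = 1}"

definition induced_subgraph :: "'a graph \<Rightarrow> 'a set \<Rightarrow> 'a graph" where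
  "induced_subgraph G A = \<lparr>verts = verts G \<inter> A, edges = {e \<in> edges G. e \<subseteq> A}\<rparr>"

definition graph_isomorphic :: "'a graph \<Rightarrow> 'b graph \<Rightarrow> bool" where
  "graph_isomorphic G H \<longleftrightarrow>
     (\<exists>f. bij_betw f (verts G) (verts H) \<and>
          (\<forall>u\<in>verts G. \<forall>v\<in>verts G. {u, v} \<in> edges G \<longleftrightarrow> {f u, f v} \<in> edges H))"

end

theory Submission
  imports Defs "HOL-Analysis.Convex"
begin

text \<open>The graph is \<open>n (m - 1)\<close>-regular, so the inequality amounts to the bound
  \<open>(m - 1) |A| log\<^sub>m |A|\<close> on the sum over \<open>A\<close> of the degrees inside \<open>A\<close>. This is an entropy
  inequality, proved by induction on \<open>n\<close>. Let \<open>k y\<close> be the number of points of \<open>A\<close> on the line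
  through \<open>y\<close> in the direction of the first coordinate, and \<open>a i\<close> the size of the slice of \<open>A\<close> at
  first coordinate \<open>i\<close>. Concavity of the logarithm gives \<open>k y - 1 \<le> (m - 1) log\<^sub>m (k y)\<close>, so the
  induction step reduces to \<open>\<Sum> (log (k y) + log (a i)) \<le> |A| log |A|\<close>, the sum being over the
  points \<open>(i, y)\<close> of \<open>A\<close>. This follows from \<open>ln z \<le> z - 1\<close> for \<open>z = k y * a i / |A|\<close>, because
  the sum of \<open>k y * a i\<close> over \<^emph>\<open>all\<close> pairs \<open>(i, y)\<close> is \<open>|A|\<^sup>2\<close>.\<close>

section \<open>Adjacency of words and degrees within a set of words\<close>

text \<open>Hamming distance exactly one. No alphabet or dimension is mentioned, so the relation
  passes unchanged to the tails of words in an induction.\<close>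

definition differ_once :: "'a list \<Rightarrow> 'a list \<Rightarrow> bool" where
  "differ_once u v \<longleftrightarrow> length u = length v \<and>
     (\<exists>j<length u. u ! j \<noteq> v ! j \<and> (\<forall>l<length u. l \<noteq> j \<longrightarrow> u ! l = v ! l))"

text \<open>\<open>u\<close> may lie outside \<open>A\<close>, so the same count covers neighbours
  inside a set, in its complement and in the whole vertex set.\<close>

definition degree_in :: "'a list set \<Rightarrow> 'a list \<Rightarrow> nat" where
  "degree_in A u = card {v \<in> A. differ_once u v}"

lemma differ_once_Nil [simp]: "\<not> differ_once [] v"
  by (simp add: differ_once_def)

lemma differ_once_sym: "differ_once u v \<Longrightarrow> differ_once v u"
  unfolding differ_once_def by metis

lemma differ_once_irrefl [simp]: "\<not> differ_once u u"
  by (simp add: differ_once_def)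

lemma differ_once_Cons:
  "differ_once (i # y) (i' # y') \<longleftrightarrow> (i \<noteq> i' \<and> y = y') \<or> (i = i' \<and> differ_once y y')"
  unfolding differ_once_def
  by (auto simp: Ex_less_Suc2 All_less_Suc2 list_eq_iff_nth_eq)

text \<open>A neighbour either changes the head and stays on the line through \<open>y\<close>, or
  keeps the head and moves inside the slice at \<open>i\<close>. Removing \<open>i\<close> excludes
  the point itself from its line.\<close>

lemma degree_in_Cons:
  assumes "finite A" and "\<And>v. v \<in> A \<Longrightarrow> v \<noteq> []"
  shows "degree_in A (i # y) = card ({i'. i' # y \<in> A} - {i}) + degree_in {y'. i # y' \<in> A} y"
proof -
  have eq: "{v \<in> A. differ_once (i # y) v} =
      (\<lambda>i'. i' # y) ` ({i'. i' # y \<in> A} - {i}) \<union> (#) i ` {y' \<in> {y'. i # y' \<in> A}. differ_once y y'}"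
    (is "_ = ?L \<union> ?R")
  proof (intro equalityI subsetI)
    fix v assume v: "v \<in> {v \<in> A. differ_once (i # y) v}"
    then obtain i' y' where "v = i' # y'" using assms(2) by (cases v) auto
    with v show "v \<in> ?L \<union> ?R" by (auto simp: differ_once_Cons)
  qed (auto simp: differ_once_Cons)
  have "finite (?L \<union> ?R)" unfolding eq[symmetric] using assms(1) by simp
  moreover have "?L \<inter> ?R = {}" by auto
  ultimately have "card (?L \<union> ?R) = card ?L + card ?R" by (intro card_Un_disjoint) auto
  then show ?thesis
    by (simp add: degree_in_def eq card_image inj_on_def)
qed

lemma finite_power_verts: "finite (verts G) \<Longrightarrow> finite (power_verts G n)"
  using finite_lists_length_eq[of "verts G" n] by (simp add: power_verts_def)

lemma card_power_verts: "finite (verts G) \<Longrightarrow> card (power_verts G n) = card (verts G) ^ n"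
  using card_lists_length_eq[of "verts G" n] by (simp add: power_verts_def)

lemma degree_in_power_verts:
  assumes "finite (verts G)" and "u \<in> power_verts G n"
  shows "degree_in (power_verts G n) u = n * (card (verts G) - 1)"
  using assms(2)
proof (induction n arbitrary: u)
  case 0
  then show ?case by (simp add: power_verts_def degree_in_def)
next
  case (Suc n)
  then obtain i y where u: "u = i # y" and i: "i \<in> verts G" and y: "y \<in> power_verts G n"
    by (cases u) (auto simp: power_verts_def)
  have "{i'. i' # y \<in> power_verts G (Suc n)} = verts G"
    and "{y'. i # y' \<in> power_verts G (Suc n)} = power_verts G n"
    using i y by (auto simp: power_verts_def)
  moreover have "degree_in (power_verts G (Suc n)) (i # y)
      = card ({i'. i' # y \<in> power_verts G (Suc n)} - {i})
        + degree_in {y'. i # y' \<in> power_verts G (Suc n)} y"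
    by (intro degree_in_Cons finite_power_verts assms(1)) (auto simp: power_verts_def)
  ultimately show ?case
    using u i assms(1) Suc.IH[OF y] by (simp add: card_Diff_singleton)
qed

section \<open>Logarithmic inequalities and entropy\<close>

text \<open>On the interval from 1 to \<open>m\<close> the concave logarithm lies above its chord;
  \<open>t\<close> is the weight that writes \<open>k\<close> as a mean of 1 and \<open>m\<close>.
  Both ends give equality, matching lines that meet the set in a single point or in full.\<close>

lemma diff_one_le_log:
  fixes m k :: real
  assumes "1 < m" "1 \<le> k" "k \<le> m"
  shows "k - 1 \<le> (m - 1) * log m k"
proof -
  define t where "t = (k - 1) / (m - 1)"
  have t: "0 \<le> t" "t \<le> 1" using assms by (auto simp: t_def)
  from concave_onD[OF ln_concave t, of 1 m] have "t * ln m \<le> ln ((1 - t) * 1 + t * m)"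
    using assms by simp
  also have "(1 - t) * 1 + t * m = 1 + t * (m - 1)" by (simp add: algebra_simps)
  also have "\<dots> = k" using assms by (simp add: t_def)
  finally have "t \<le> log m k" using assms by (simp add: log_def pos_le_divide_eq)
  then show ?thesis using assms by (simp add: t_def pos_divide_le_eq mult.commute)
qed

lemma sum_fibers:
  fixes g :: "'a \<Rightarrow> 'b \<Rightarrow> 'c::comm_monoid_add"
  assumes "finite P"
  shows "(\<Sum>(i, y)\<in>P. g i y) = (\<Sum>i\<in>fst ` P. \<Sum>y\<in>P `` {i}. g i y)"
proof -
  have P: "Sigma (fst ` P) (\<lambda>i. P `` {i}) = P" by force
  have "(\<Sum>i\<in>fst ` P. \<Sum>y\<in>P `` {i}. g i y) = (\<Sum>(i, y)\<in>Sigma (fst ` P) (\<lambda>i. P `` {i}). g i y)"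
    using assms by (intro sum.Sigma) (auto intro: finite_Image)
  then show ?thesis by (simp only: P)
qed

lemma card_eq_sum_fibers: "finite P \<Longrightarrow> card P = (\<Sum>i\<in>fst ` P. card (P `` {i}))"
  using sum_fibers[of P "\<lambda>_ _. 1 :: nat"] by (simp add: case_prod_unfold)

text \<open>Subadditivity of entropy, in terms of the fibres of the two coordinate projections.\<close>
lemma sum_log_fibers_le:
  fixes A :: "('a \<times> 'b) set" and m :: real
  assumes "finite A" and "1 < m"
  defines "a \<equiv> \<lambda>i. card (A `` {i})" and "k \<equiv> \<lambda>y. card (A\<inverse> `` {y})"
  shows "(\<Sum>(i, y)\<in>A. log m (real (k y)) + log m (real (a i))) \<le> real (card A) * log m (real (card A))"
proof (cases "A = {}")
  case False
  define N where "N = real (card A)"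
  have N: "N > 0" using False assms(1) by (simp add: N_def card_gt_0_iff)
  have fibers: "finite (A `` {i})" "finite (A\<inverse> `` {y})" for i y
    using assms(1) by (auto intro: finite_Image)
  have pos: "a i > 0" "k y > 0" if "(i, y) \<in> A" for i y
    using that fibers by (auto simp: a_def k_def card_gt_0_iff)
  have sum_a: "(\<Sum>i\<in>fst ` A. real (a i)) = N"
    using card_eq_sum_fibers[OF assms(1)] by (simp add: N_def a_def)
  have sum_k: "(\<Sum>y\<in>snd ` A. real (k y)) = N"
  proof -
    \<comment> \<open>The converse relation swaps the two projections, so the count by first
      coordinates also serves for second coordinates.\<close>
    have "fst ` (A\<inverse>) = snd ` A" by force
    then show ?thesis
      using card_eq_sum_fibers[of "A\<inverse>"] assms(1) by (simp add: N_def k_def card_inverse)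
  qed
  \<comment> \<open>Passing from \<open>A\<close> to the product of its projections only adds
    nonnegative terms, and over a product the sum factors.\<close>
  have "(\<Sum>(i, y)\<in>A. real (k y) * real (a i)) \<le> (\<Sum>(i, y)\<in>fst ` A \<times> snd ` A. real (k y) * real (a i))"
    using assms(1) by (intro sum_mono2) (auto simp: rev_image_eqI)
  also have "\<dots> = (\<Sum>i\<in>fst ` A. real (a i)) * (\<Sum>y\<in>snd ` A. real (k y))"
    by (simp add: sum.cartesian_product[symmetric] sum_product mult.commute)
  finally have prod_le: "(\<Sum>(i, y)\<in>A. real (k y) * real (a i)) \<le> N * N"
    by (simp only: sum_a sum_k)
  have "(\<Sum>(i, y)\<in>A. ln (real (k y)) + ln (real (a i)) - ln N)
      \<le> (\<Sum>(i, y)\<in>A. real (k y) * real (a i) / N - 1)"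
  proof (intro sum_mono, clarify)
    fix i y assume "(i, y) \<in> A"
    then show "ln (real (k y)) + ln (real (a i)) - ln N \<le> real (k y) * real (a i) / N - 1"
      using pos N ln_le_minus_one[of "real (k y) * real (a i) / N"]
      by (simp add: ln_mult ln_div)
  qed
  also have "\<dots> = (\<Sum>(i, y)\<in>A. real (k y) * real (a i)) / N - N"
    by (simp add: case_prod_unfold sum_subtractf sum_divide_distrib N_def)
  also have "\<dots> \<le> 0" using prod_le N by (simp add: divide_le_eq)
  finally have "(\<Sum>(i, y)\<in>A. ln (real (k y)) + ln (real (a i))) \<le> N * ln N"
    by (simp add: case_prod_unfold sum_subtractf N_def)
  then have "(\<Sum>(i, y)\<in>A. ln (real (k y)) + ln (real (a i))) / ln m \<le> N * ln N / ln m"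
    using assms(2) by (intro divide_right_mono) auto
  then show ?thesis
    by (simp add: log_def N_def case_prod_unfold sum_divide_distrib add_divide_distrib)
qed simp

section \<open>The entropy bound on the sum of inner degrees\<close>

lemma sum_degree_in_le:
  fixes A :: "'a list set"
  assumes "finite S" and "card S \<le> m" and "2 \<le> m"
    and "A \<subseteq> {u. set u \<subseteq> S \<and> length u = n}"
  shows "real (\<Sum>u\<in>A. degree_in A u) \<le> (real m - 1) * (real (card A) * log (real m) (real (card A)))"
  using assms(4)
proof (induction n arbitrary: A)
  case 0
  \<comment> \<open>Both sides vanish: the factor \<open>card A\<close> is zero for the empty set,
    and the logarithm of 1 is zero for the singleton.\<close>
  then have "A = {} \<or> A = {[]}" by auto
  then show ?case by (auto simp: degree_in_def)
next
  case (Suc n)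
  \<comment> \<open>\<open>P\<close> is \<open>A\<close> as a relation between heads and tails: its
    images are the slices, and the images of its converse are the lines.\<close>
  define P where "P = {(i, y). i # y \<in> A}"
  have finA: "finite A"
    using finite_subset[OF Suc.prems finite_lists_length_eq[OF assms(1)]] .
  have nonNil: "v \<noteq> []" if "v \<in> A" for v using that Suc.prems by auto
  have bij: "bij_betw (\<lambda>(i, y). i # y) P A"
    unfolding bij_betw_def
  proof
    show "inj_on (\<lambda>(i, y). i # y) P" by (auto simp: inj_on_def)
    show "(\<lambda>(i, y). i # y) ` P = A"
    proof (intro equalityI subsetI)
      fix v assume "v \<in> A"
      then show "v \<in> (\<lambda>(i, y). i # y) ` P"
        using nonNil[of v] by (cases v) (auto simp: P_def image_iff)
    qed (auto simp: P_def)
  qed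
  have finP: "finite P" and cardP: "card P = card A"
    using bij finA bij_betw_finite bij_betw_same_card by blast+
  define a where "a = (\<lambda>i. card (P `` {i}))"
  define k where "k = (\<lambda>y. card (P\<inverse> `` {y}))"
  have line: "{i'. i' # y \<in> A} = P\<inverse> `` {y}" and slice: "{y'. i # y' \<in> A} = P `` {i}" for i y
    by (auto simp: P_def)
  have fib: "finite (P `` {i})" "finite (P\<inverse> `` {y})" for i y
    using finP by (auto intro: finite_Image)
  have k_bounds: "1 \<le> k y" "k y \<le> m" if "(i, y) \<in> P" for i y
  proof -
    show "1 \<le> k y" using that fib unfolding k_def by (simp add: Suc_le_eq card_gt_0_iff) blast
    have "P\<inverse> `` {y} \<subseteq> S" using Suc.prems by (auto simp: P_def)
    then show "k y \<le> m" unfolding k_def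
      using card_mono[OF assms(1)] assms(2) le_trans by blast
  qed
  have deg: "degree_in A (i # y) = (k y - 1) + degree_in (P `` {i}) y" if "(i, y) \<in> P" for i y
    using degree_in_Cons[OF finA nonNil, of i y] that fib
    by (simp add: line slice k_def card_Diff_singleton)
  have "real (\<Sum>u\<in>A. degree_in A u) = (\<Sum>(i, y)\<in>P. real (degree_in A (i # y)))"
    using sum.reindex_bij_betw[OF bij, of "\<lambda>u. real (degree_in A u)"] by (simp add: case_prod_unfold)
  also have "\<dots> = (\<Sum>(i, y)\<in>P. (real (k y) - 1) + real (degree_in (P `` {i}) y))"
  proof (intro sum.cong refl, clarify)
    fix i y assume "(i, y) \<in> P"
    then show "real (degree_in A (i # y)) = (real (k y) - 1) + real (degree_in (P `` {i}) y)"
      \<comment> \<open>The truncated difference \<open>k y - 1\<close> becomes a real one because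
        the line contains the point itself.\<close>
      using k_bounds(1)[of i y] by (simp only: deg of_nat_add of_nat_diff of_nat_1)
  qed
  also have "\<dots> = (\<Sum>(i, y)\<in>P. real (k y) - 1) + (\<Sum>(i, y)\<in>P. real (degree_in (P `` {i}) y))"
    by (simp add: case_prod_unfold sum.distrib)
  also have "\<dots> \<le> (\<Sum>(i, y)\<in>P. (real m - 1) * log (real m) (real (k y)))
      + (\<Sum>(i, y)\<in>P. (real m - 1) * log (real m) (real (a i)))"
  proof (rule add_mono)
    show "(\<Sum>(i, y)\<in>P. real (k y) - 1) \<le> (\<Sum>(i, y)\<in>P. (real m - 1) * log (real m) (real (k y)))"
    proof (intro sum_mono, clarify)
      fix i y assume "(i, y) \<in> P"
      then show "real (k y) - 1 \<le> (real m - 1) * log (real m) (real (k y))"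
        using k_bounds[of i y] assms(3) by (intro diff_one_le_log) auto
    qed
    \<comment> \<open>The induction hypothesis for one slice. Its bound is spread as a constant over
      the \<open>a i\<close> points of the slice, so that the slices add up to a sum over
      \<open>P\<close>.\<close>
    have "(\<Sum>y\<in>P `` {i}. real (degree_in (P `` {i}) y))
        \<le> (\<Sum>y\<in>P `` {i}. (real m - 1) * log (real m) (real (a i)))" for i
    proof -
      have "P `` {i} \<subseteq> {u. set u \<subseteq> S \<and> length u = n}"
        using Suc.prems unfolding P_def by force
      from Suc.IH[OF this] show ?thesis by (simp add: a_def mult.left_commute)
    qed
    then show "(\<Sum>(i, y)\<in>P. real (degree_in (P `` {i}) y))
        \<le> (\<Sum>(i, y)\<in>P. (real m - 1) * log (real m) (real (a i)))"
      unfolding sum_fibers[OF finP] by (rule sum_mono)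
  qed
  also have "\<dots> = (real m - 1) * (\<Sum>(i, y)\<in>P. log (real m) (real (k y)) + log (real m) (real (a i)))"
    by (simp add: case_prod_unfold sum.distrib sum_distrib_left distrib_left)
  also have "\<dots> \<le> (real m - 1) * (real (card A) * log (real m) (real (card A)))"
    using sum_log_fibers_le[OF finP, of "real m"] assms(3)
    by (intro mult_left_mono) (auto simp: a_def k_def cardP)
  finally show ?case .
qed

section \<open>Edge boundaries and induced copies in Hamming graphs\<close>

lemma verts_hamming: "verts (hamming_graph n m) = power_verts (complete_graph m) n"
  by (simp add: hamming_graph_def power_graph_def)

text \<open>All letters of a vertex lie in \<open>{1..m}\<close>, where adjacency in the complete
  graph is mere inequality.\<close>

lemma edge_hamming_iff:
  "{u, v} \<in> edges (hamming_graph n m) \<longleftrightarrow>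
     u \<in> verts (hamming_graph n m) \<and> v \<in> verts (hamming_graph n m) \<and> differ_once u v"
proof -
  have nth: "w ! j \<in> {1..m}" if "w \<in> power_verts (complete_graph m) n" "j < n" for w j
    using that nth_mem[of j w] unfolding power_verts_def complete_graph_def by force
  have edge: "{a, b} \<in> edges (complete_graph m) \<longleftrightarrow> a \<in> {1..m} \<and> b \<in> {1..m} \<and> a \<noteq> b" for a b
    unfolding complete_graph_def by (auto simp: doubleton_eq_iff)
  have adj: "(\<exists>j<n. {u ! j, v ! j} \<in> edges (complete_graph m) \<and> (\<forall>l<n. l \<noteq> j \<longrightarrow> u ! l = v ! l))
      \<longleftrightarrow> differ_once u v"
    if "u \<in> power_verts (complete_graph m) n" "v \<in> power_verts (complete_graph m) n" for u v
  proof -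
    have "length u = n" "length v = n" using that by (auto simp: power_verts_def)
    then show ?thesis unfolding differ_once_def edge using nth that by auto
  qed
  have "edges (hamming_graph n m) = {{u, v} | u v. u \<in> power_verts (complete_graph m) n \<and>
      v \<in> power_verts (complete_graph m) n \<and> differ_once u v}"
    unfolding hamming_graph_def power_graph_def by (simp add: adj cong: conj_cong)
  then show ?thesis
    unfolding verts_hamming by (auto simp: doubleton_eq_iff intro: differ_once_sym)
qed

lemma edge_hammingE:
  assumes "e \<in> edges (hamming_graph n m)"
  obtains u v where "e = {u, v}"
  using assms unfolding hamming_graph_def power_graph_def by auto

lemma sum_degree_in:
  assumes "finite A" and "finite B"
  shows "(\<Sum>u\<in>A. degree_in B u) = card {(u, v). u \<in> A \<and> v \<in> B \<and> differ_once u v}"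
proof -
  have "{(u, v). u \<in> A \<and> v \<in> B \<and> differ_once u v} = Sigma A (\<lambda>u. {v \<in> B. differ_once u v})"
    by auto
  then show ?thesis using assms by (simp add: degree_in_def)
qed

text \<open>Double counting: each vertex of \<open>A\<close> has degree \<open>n * (m - 1)\<close>,
  and its neighbours split into those inside and those outside \<open>A\<close>. Edges inside
  \<open>A\<close> are counted from both ends, boundary edges once.\<close>

lemma edge_boundary_hamming:
  assumes "A \<subseteq> verts (hamming_graph n m)"
  shows "edge_boundary (hamming_graph n m) A + (\<Sum>u\<in>A. degree_in A u) = card A * (n * (m - 1))"
proof -
  let ?V = "verts (hamming_graph n m)"
  have finV: "finite ?V"
    unfolding verts_hamming by (intro finite_power_verts) (simp add: complete_graph_def)
  then have finA: "finite A" using assms finite_subset by blast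
  let ?B = "{(u, v). u \<in> A \<and> v \<in> ?V - A \<and> differ_once u v}"
  \<comment> \<open>Each boundary edge is oriented away from its unique endpoint in
    \<open>A\<close>.\<close>
  have "bij_betw (\<lambda>(u, v). {u, v}) ?B {e \<in> edges (hamming_graph n m). card (e \<inter> A) = 1}"
    unfolding bij_betw_def
  proof
    show "inj_on (\<lambda>(u, v). {u, v}) ?B" by (auto simp: inj_on_def doubleton_eq_iff)
    show "(\<lambda>(u, v). {u, v}) ` ?B = {e \<in> edges (hamming_graph n m). card (e \<inter> A) = 1}"
    proof (intro equalityI subsetI)
      fix e assume "e \<in> (\<lambda>(u, v). {u, v}) ` ?B"
      then obtain u v where "e = {u, v}" "u \<in> A" "v \<in> ?V" "v \<notin> A" "differ_once u v" by auto
      then show "e \<in> {e \<in> edges (hamming_graph n m). card (e \<inter> A) = 1}"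
        using assms by (auto simp: edge_hamming_iff Int_insert_left)
    next
      fix e assume e: "e \<in> {e \<in> edges (hamming_graph n m). card (e \<inter> A) = 1}"
      then obtain u v where uv: "e = {u, v}" by (auto elim: edge_hammingE)
      have V: "u \<in> ?V" "v \<in> ?V" and d: "differ_once u v"
        using e by (auto simp: uv edge_hamming_iff)
      have ne: "u \<noteq> v" using d by auto
      have c: "card ({u, v} \<inter> A) = 1" using e uv by simp
      have "(u \<in> A \<and> v \<notin> A) \<or> (v \<in> A \<and> u \<notin> A)"
        using c ne by (cases "u \<in> A"; cases "v \<in> A") (auto simp: Int_insert_left)
      then show "e \<in> (\<lambda>(u, v). {u, v}) ` ?B"
      proof
        assume "u \<in> A \<and> v \<notin> A"
        then show ?thesis using V d uv by (intro image_eqI[of _ _ "(u, v)"]) auto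
      next
        assume "v \<in> A \<and> u \<notin> A"
        then show ?thesis using V differ_once_sym[OF d] uv
          by (intro image_eqI[of _ _ "(v, u)"]) auto
      qed
    qed
  qed
  then have "edge_boundary (hamming_graph n m) A = (\<Sum>u\<in>A. degree_in (?V - A) u)"
    using sum_degree_in[OF finA, of "?V - A"] finV
    by (simp add: edge_boundary_def bij_betw_same_card)
  then have "edge_boundary (hamming_graph n m) A + (\<Sum>u\<in>A. degree_in A u)
      = (\<Sum>u\<in>A. degree_in (?V - A) u + degree_in A u)"
    by (simp add: sum.distrib)
  also have "\<dots> = (\<Sum>u\<in>A. degree_in ?V u)"
  proof (rule sum.cong)
    fix u
    have "{v \<in> ?V. differ_once u v} = {v \<in> ?V - A. differ_once u v} \<union> {v \<in> A. differ_once u v}"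
      using assms by auto
    moreover have "card ({v \<in> ?V - A. differ_once u v} \<union> {v \<in> A. differ_once u v})
        = degree_in (?V - A) u + degree_in A u"
      unfolding degree_in_def using finV finA by (intro card_Un_disjoint) auto
    ultimately show "degree_in (?V - A) u + degree_in A u = degree_in ?V u"
      by (simp add: degree_in_def)
  qed simp
  also have "\<dots> = (\<Sum>u\<in>A. n * (m - 1))"
    using assms unfolding verts_hamming
    by (intro sum.cong refl) (auto simp: degree_in_power_verts complete_graph_def)
  finally show ?thesis by simp
qed

text \<open>An isomorphism carries ordered adjacent pairs to ordered adjacent pairs, so the degree
  sum is that of the \<open>t * (m - 1)\<close>-regular graph on \<open>m ^ t\<close>
  vertices.\<close>

lemma induced_hamming_copy:
  assumes "A \<subseteq> verts (hamming_graph n m)"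
    and "graph_isomorphic (induced_subgraph (hamming_graph n m) A) (hamming_graph t m)"
  shows "card A = m ^ t" and "(\<Sum>u\<in>A. degree_in A u) = m ^ t * (t * (m - 1))"
proof -
  let ?W = "verts (hamming_graph t m)"
  have fin: "finite (verts (hamming_graph s m))" for s
    unfolding verts_hamming by (intro finite_power_verts) (simp add: complete_graph_def)
  have finA: "finite A" using assms(1) fin finite_subset by blast
  have cardW: "card ?W = m ^ t"
    unfolding verts_hamming by (simp add: card_power_verts complete_graph_def)
  have "verts (induced_subgraph (hamming_graph n m) A) = A"
    using assms(1) by (auto simp: induced_subgraph_def)
  then obtain f where f: "bij_betw f A ?W"
    and "\<forall>u\<in>A. \<forall>v\<in>A. {u, v} \<in> edges (induced_subgraph (hamming_graph n m) A) \<longleftrightarrow>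
      {f u, f v} \<in> edges (hamming_graph t m)"
    using assms(2) by (auto simp: graph_isomorphic_def)
  then have adj: "differ_once (f u) (f v) \<longleftrightarrow> differ_once u v" if "u \<in> A" "v \<in> A" for u v
    using that assms(1) bij_betwE[OF f]
    by (auto simp: induced_subgraph_def edge_hamming_iff)
  show "card A = m ^ t" using bij_betw_same_card[OF f] cardW by simp
  have "bij_betw (map_prod f f) {(u, v). u \<in> A \<and> v \<in> A \<and> differ_once u v}
      {(u, v). u \<in> ?W \<and> v \<in> ?W \<and> differ_once u v}"
    unfolding bij_betw_def
  proof
    show "inj_on (map_prod f f) {(u, v). u \<in> A \<and> v \<in> A \<and> differ_once u v}"
      using f by (auto simp: bij_betw_def inj_on_def)
    have "f ` A = ?W" using f by (simp add: bij_betw_def)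
    then show "map_prod f f ` {(u, v). u \<in> A \<and> v \<in> A \<and> differ_once u v}
        = {(u, v). u \<in> ?W \<and> v \<in> ?W \<and> differ_once u v}"
      by (auto simp: adj image_iff) (metis adj imageE)
  qed
  then have "(\<Sum>u\<in>A. degree_in A u) = (\<Sum>u\<in>?W. degree_in ?W u)"
    using finA fin by (simp add: sum_degree_in bij_betw_same_card)
  also have "\<dots> = (\<Sum>u\<in>?W. t * (m - 1))"
    unfolding verts_hamming
    by (intro sum.cong refl) (auto simp: degree_in_power_verts complete_graph_def)
  finally show "(\<Sum>u\<in>A. degree_in A u) = m ^ t * (t * (m - 1))" using cardW by simp
qed

theorem mainTheorem7:
  fixes m n :: nat and A :: "nat list set"
  assumes "m \<ge> 2" and "n \<ge> 1"
    and "A \<subseteq> verts (hamming_graph n m)" and "A \<noteq> {}"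
  shows "real (edge_boundary (hamming_graph n m) A)
           \<ge> real (card A) * (real m - 1) * (real n - log (real m) (real (card A)))
       \<and> (\<forall>t\<in>{1..n}.
            graph_isomorphic (induced_subgraph (hamming_graph n m) A) (hamming_graph t m) \<longrightarrow>
            real (edge_boundary (hamming_graph n m) A)
              = real (card A) * (real m - 1) * (real n - log (real m) (real (card A))))"
proof (intro conjI ballI impI)
  \<comment> \<open>\<open>D\<close> is twice the number of edges inside \<open>A\<close>; an upper
    bound on it is a lower bound on the boundary.\<close>
  define D where "D = (\<Sum>u\<in>A. degree_in A u)"
  have "real (edge_boundary (hamming_graph n m) A + D) = real (card A * (n * (m - 1)))"
    unfolding D_def edge_boundary_hamming[OF assms(3)] ..
  then have boundary: "real (edge_boundary (hamming_graph n m) A)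
      = real (card A) * (real n * (real m - 1)) - real D"
    using assms(1) by (simp add: of_nat_diff)
  have "A \<subseteq> {u. set u \<subseteq> {1..m} \<and> length u = n}"
    using assms(3) by (simp add: verts_hamming power_verts_def complete_graph_def)
  then have "real D \<le> (real m - 1) * (real (card A) * log (real m) (real (card A)))"
    unfolding D_def using assms(1) by (intro sum_degree_in_le) auto
  then show "real (edge_boundary (hamming_graph n m) A)
      \<ge> real (card A) * (real m - 1) * (real n - log (real m) (real (card A)))"
    unfolding boundary by (simp add: algebra_simps)
  fix t
  assume "graph_isomorphic (induced_subgraph (hamming_graph n m) A) (hamming_graph t m)"
  note copy = induced_hamming_copy[OF assms(3) this]
  \<comment> \<open>For a copy, \<open>D\<close> attains the entropy bound exactly, since the
    logarithm of \<open>card A\<close> is \<open>t\<close>.\<close>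
  have "real D = real m ^ t * (real t * (real m - 1))"
    using copy(2) assms(1) by (simp add: D_def of_nat_diff)
  moreover have "log (real m) (real (card A)) = real t"
    using assms(1) by (simp add: copy(1) log_nat_power)
  ultimately show "real (edge_boundary (hamming_graph n m) A)
      = real (card A) * (real m - 1) * (real n - log (real m) (real (card A)))"
    unfolding boundary by (simp add: copy(1) algebra_simps)
qed

end
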